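(* Let $\prec$ be a well-order on $\mathbb{N}$ with order type $|{\prec}|$, and let $h>0$ be a natural number. If $|{\prec}|>\omega^{h+1}+\omega$, then Delayer has a winning strategy for the game $\mathcal{G}_1(\prec,h)$.
   Context: **Trees.** $\omega^{<\omega}$ is the set of finite sequences of natural numbers, $*$ is concatenation ($\sigma*k$ appends the number $k$), $\subseteq$ is the initial segment relation and $\subsetneq$ its proper version. A rooted tree is a nonempty subset of $\omega^{<\omega}$ closed under initial segments; $\sigma*k$ is a child of its parent $\sigma$; leaves are nodes without children; the height of a node is its length and the height of a finite tree is the maximum height of its nodes. A comb of height $\le h$ is a finite rooted tree $T$ of height $\le h$ such that the children of each non-leaf $\sigma$ are the $\sigma*i$ with $i$ in a nonempty interval of consecutive natural numbers, and, with $c(T)$ denoting the lexicographically least (leftmost) leaf, every parent of a leaf is a proper initial segment of $c(T)$. A finite partial predicate is a function from a finite subset of $\mathbb{N}$ to $\{0,1\}$; $\mathcal{R}$ is the set of these. **The game $\mathcal{G}_1(\prec,h)$** ($h\in\omega$), played by Prover and Delayer. A possible position is a pair $(T,\rho)$ with $T$ a comb of height $\le h$ and $\rho\in\mathcal{R}$. Delayer chooses $m_0\in\mathbb{N}$ and the initial position is $(\{\emptyset\},\{m_0\mapsto1\})$. At position $(T,\rho)$: (a) Prover plays a finite set $Q\subseteq\mathbb{N}$. (b) Delayer plays $\rho'\in\mathcal{R}$ with $Q\subseteq\mathrm{dom}(\rho')$ such that for every $q\in Q$ with $\rho'(q)=1$ there is $p\prec q$ with $\rho'(p)=1$. If $\rho\cup\rho'$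 is not a function, the play ends and Prover wins. Otherwise: (c) Prover plays $\langle o,b\rangle$ with either $o=0$ and $b\in\omega$, or $o=1$ and $b\in\omega^{<\omega}$ with $b\subsetneq c(T)$. (d) If $o=0$, let $T'=T\cup\{c(T)*i\mid 0\le i\le b\}$; if $T'$ has height $>h$ the game ends and Prover loses, otherwise the next position is $(T',\rho\cup\rho')$. If $o=1$, write $c(T)=b*k*\sigma$ with $k\in\omega$; if $b*(k+1)\notin T$ the game ends and Prover loses, otherwise the next position is $(T\setminus\{b*k*\tau\mid\tau\in\omega^{<\omega}\},\rho\cup\rho')$. Strategies may depend on the whole history of the play; a winning strategy is one that wins against every strategy of the opponent. Prover losing means Delayer wins. *)

theory Defs
  imports Main "HOL-Library.Sublist"
begin

section \<open>Ordinals\<close>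

text \<open>
  Ordinals are represented by (reflexive) well-order relations and compared by the
  relation \<open>ordLess\<close> of Main. Sum and product are the usual ordinal operations: in the sum the
  right summand comes last, in the product the right factor is the more significant one.
\<close>

definition ord_sum :: "'a rel \<Rightarrow> 'b rel \<Rightarrow> ('a + 'b) rel" where
  "ord_sum r s = {(Inl x, Inl x') | x x'. (x, x') \<in> r}
     \<union> {(Inr y, Inr y') | y y'. (y, y') \<in> s}
     \<union> {(Inl x, Inr y) | x y. x \<in> Field r \<and> y \<in> Field s}"

definition ord_prod :: "'a rel \<Rightarrow> 'b rel \<Rightarrow> ('a \<times> 'b) rel" where
  "ord_prod r s = {((x, y), (x', y')) | x y x' y'.
     x \<in> Field r \<and> x' \<in> Field r \<and> y \<in> Field s \<and> y' \<in> Field s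
     \<and> ((y, y') \<in> s \<and> y \<noteq> y' \<or> y = y' \<and> (x, x') \<in> r)}"

text \<open>
  The ordinal powers of \<open>\<omega>\<close> (that is, of \<open>natLeq\<close>): the recursion is
  \<open>\<omega>\<close>-power \<open>n + 1\<close> = (\<open>\<omega>\<close>-power \<open>n\<close>) times \<open>\<omega>\<close>, where a pair \<open>(xs, x)\<close> is coded as the list
  \<open>x # xs\<close> so that all powers live on the same type.
\<close>

primrec omega_pow :: "nat \<Rightarrow> nat list rel" where
  "omega_pow 0 = {([], [])}"
| "omega_pow (Suc n) = dir_image (ord_prod (omega_pow n) natLeq) (\<lambda>(xs, x). x # xs)"

lemma ord_sum_iff:
  "(Inl x, Inl x') \<in> ord_sum r s \<longleftrightarrow> (x, x') \<in> r"
  "(Inr y, Inr y') \<in> ord_sum r s \<longleftrightarrow> (y, y') \<in> s"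
  "(Inl x, Inr y) \<in> ord_sum r s \<longleftrightarrow> x \<in> Field r \<and> y \<in> Field s"
  "(Inr y, Inl x) \<in> ord_sum r s \<longleftrightarrow> False"
  unfolding ord_sum_def by auto

lemma ord_prod_iff:
  "((x, y), (x', y')) \<in> ord_prod r s \<longleftrightarrow>
     x \<in> Field r \<and> x' \<in> Field r \<and> y \<in> Field s \<and> y' \<in> Field s
     \<and> ((y, y') \<in> s \<and> y \<noteq> y' \<or> y = y' \<and> (x, x') \<in> r)"
  unfolding ord_prod_def by auto

lemma in_Field_iff: "x \<in> Field r \<longleftrightarrow> (\<exists>y. (x, y) \<in> r \<or> (y, x) \<in> r)"
  by (auto simp: Field_def)

lemma Well_order_iff:
  "Well_order r \<longleftrightarrow> Refl r \<and> trans r \<and> antisym r \<and> Total r \<and> wf (r - Id)"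
  unfolding well_order_on_def linear_order_on_def partial_order_on_def preorder_on_def
  by (auto simp: Field_def)

lemma Inl_Field_ord_sum: "Inl x \<in> Field (ord_sum r s) \<longleftrightarrow> x \<in> Field r"
  unfolding in_Field_iff[of "Inl x"] split_sum_ex ord_sum_iff by (auto simp: Field_def)

lemma Inr_Field_ord_sum: "Inr y \<in> Field (ord_sum r s) \<longleftrightarrow> y \<in> Field s"
  unfolding in_Field_iff[of "Inr y"] split_sum_ex ord_sum_iff by (auto simp: Field_def)

lemma Well_order_ord_sum:
  assumes r: "Well_order r" and s: "Well_order s"
  shows "Well_order (ord_sum r s)"
proof -
  let ?t = "ord_sum r s"
  note simps = split_sum_all ord_sum_iff Inl_Field_ord_sum Inr_Field_ord_sum
  note r' = r[unfolded Well_order_iff] and s' = s[unfolded Well_order_iff]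
  have 1: "Refl ?t"
    using r' s' by (simp add: refl_on_def Ball_def simps)
  have 2: "trans ?t"
    using r' s' unfolding trans_def simps by (meson FieldI1 FieldI2)
  have 3: "antisym ?t"
    using r' s' unfolding antisym_def simps by simp
  have 4: "Total ?t"
    using r' s' unfolding total_on_def Ball_def simps by simp
  have 5: "wf (?t - Id)"
  proof (rule wfI_min)
    fix z Q assume zQ: "z \<in> (Q :: ('a + 'b) set)"
    show "\<exists>z\<in>Q. \<forall>y. (y, z) \<in> ?t - Id \<longrightarrow> y \<notin> Q"
    proof (cases "\<exists>x. Inl x \<in> Q")
      case True
      then obtain x where "x \<in> Inl -` Q" by auto
      with r' obtain m where "m \<in> Inl -` Q" "\<And>y. (y, m) \<in> r - Id \<Longrightarrow> y \<notin> Inl -` Q"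
        by (meson wfE_min)
      then show ?thesis by (intro bexI[of _ "Inl m"]) (simp_all add: simps)
    next
      case False
      then obtain x where "x \<in> Inr -` Q" using zQ by (cases z) auto
      with s' obtain m where "m \<in> Inr -` Q" "\<And>y. (y, m) \<in> s - Id \<Longrightarrow> y \<notin> Inr -` Q"
        by (meson wfE_min)
      then show ?thesis using False by (intro bexI[of _ "Inr m"]) (simp_all add: simps)
    qed
  qed
  show ?thesis using 1 2 3 4 5 by (simp add: Well_order_iff)
qed

lemma Field_ord_prod:
  assumes "Refl r"
  shows "(x, y) \<in> Field (ord_prod r s) \<longleftrightarrow> x \<in> Field r \<and> y \<in> Field s"
  using assms unfolding in_Field_iff[of "(x, y)"] split_paired_Ex ord_prod_iff
  by (auto dest: refl_onD)

lemma Well_order_ord_prod: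
  assumes r: "Well_order r" and s: "Well_order s"
  shows "Well_order (ord_prod r s)"
proof -
  let ?t = "ord_prod r s"
  note r' = r[unfolded Well_order_iff] and s' = s[unfolded Well_order_iff]
  have R: "Refl r" using r' by simp
  note simps = split_paired_All ord_prod_iff Field_ord_prod[OF R]
  have 1: "Refl ?t"
    using r' by (simp add: refl_on_def Ball_def simps)
  have 2: "trans ?t"
    using r' s' unfolding trans_def antisym_def simps by metis
  have 3: "antisym ?t"
    using r' s' unfolding antisym_def simps by auto
  have 4: "Total ?t"
    using r' s' unfolding total_on_def Ball_def simps by blast
  have "?t - Id \<subseteq> inv_image ((s - Id) <*lex*> (r - Id)) (\<lambda>(x, y). (y, x))"
    by (auto simp: ord_prod_def)
  moreover have "wf \<dots>" using r' s' by (intro wf_inv_image wf_lex_prod) auto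
  ultimately have 5: "wf (?t - Id)" using wf_subset by blast
  show ?thesis using 1 2 3 4 5 by (simp add: Well_order_iff)
qed

lemma Well_order_omega_pow: "Well_order (omega_pow n)"
proof (induction n)
  case 0
  show ?case
    by (auto simp: well_order_on_def linear_order_on_def partial_order_on_def preorder_on_def
        refl_on_def trans_def antisym_def total_on_def Field_def)
next
  case (Suc n)
  then show ?case
    by (auto intro!: Well_order_dir_image Well_order_ord_prod natLeq_Well_order inj_onI)
qed


section \<open>Trees and combs\<close>

type_synonym node = "nat list"

definition rooted_tree :: "node set \<Rightarrow> bool" where
  "rooted_tree T \<longleftrightarrow> T \<noteq> {} \<and> (\<forall>\<sigma>\<in>T. \<forall>\<tau>. prefix \<tau> \<sigma> \<longrightarrow> \<tau> \<in> T)"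

definition leaves :: "node set \<Rightarrow> node set" where
  "leaves T = {\<sigma> \<in> T. \<forall>k. \<sigma> @ [k] \<notin> T}"

text \<open>Only meaningful for finite nonempty sets.\<close>

definition height :: "node set \<Rightarrow> nat" where
  "height T = Max (length ` T)"

definition is_leftmost_leaf :: "node set \<Rightarrow> node \<Rightarrow> bool" where
  "is_leftmost_leaf T \<sigma> \<longleftrightarrow>
     \<sigma> \<in> leaves T \<and> (\<forall>\<tau>\<in>leaves T. \<tau> \<noteq> \<sigma> \<longrightarrow> (\<sigma>, \<tau>) \<in> lexord less_than)"

text \<open>The node \<open>c(T)\<close>.\<close>

definition leftmost_leaf :: "node set \<Rightarrow> node" where
  "leftmost_leaf T = (THE \<sigma>. is_leftmost_leaf T \<sigma>)"

definition comb :: "nat \<Rightarrow> node set \<Rightarrow> bool" where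
  "comb h T \<longleftrightarrow> finite T \<and> rooted_tree T \<and> height T \<le> h
     \<and> (\<forall>\<sigma>\<in>T - leaves T. \<exists>a b. a \<le> b \<and> {i. \<sigma> @ [i] \<in> T} = {a..b})
     \<and> (\<forall>\<sigma> i. \<sigma> @ [i] \<in> leaves T \<longrightarrow> strict_prefix \<sigma> (leftmost_leaf T))"


section \<open>The game\<close>

text \<open>
  Finite partial predicates are maps with finite domain; \<open>True\<close> stands for 1 and \<open>False\<close> for 0.
\<close>

type_synonym partial_pred = "nat \<rightharpoonup> bool"

text \<open>\<open>Extend b\<close> is Prover's move \<open>\<langle>0, b\<rangle>\<close> and \<open>Prune b\<close> is the move \<open>\<langle>1, b\<rangle>\<close>.\<close>

datatype choice = Extend nat | Prune node

text \<open>A completed round: Prover's set \<open>Q\<close>, Delayer's answer, Prover's choice.\<close>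

type_synonym game_round = "nat set \<times> partial_pred \<times> choice"

definition legal_answer :: "nat rel \<Rightarrow> nat set \<Rightarrow> partial_pred \<Rightarrow> bool" where
  "legal_answer prec Q \<rho>' \<longleftrightarrow> finite (dom \<rho>') \<and> Q \<subseteq> dom \<rho>'
     \<and> (\<forall>q\<in>Q. \<rho>' q = Some True \<longrightarrow> (\<exists>p. (p, q) \<in> prec - Id \<and> \<rho>' p = Some True))"

text \<open>The union of two partial predicates is a function; it is then \<open>\<rho> ++ \<rho>'\<close>.\<close>

definition compatible :: "partial_pred \<Rightarrow> partial_pred \<Rightarrow> bool" where
  "compatible \<rho> \<rho>' \<longleftrightarrow> (\<forall>n \<in> dom \<rho> \<inter> dom \<rho>'. \<rho> n = \<rho>' n)"

fun legal_choice :: "node set \<Rightarrow> choice \<Rightarrow> bool" where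
  "legal_choice T (Extend b) \<longleftrightarrow> True"
| "legal_choice T (Prune b) \<longleftrightarrow> strict_prefix b (leftmost_leaf T)"

text \<open>
  The tree of the next position (given height bound \<open>h\<close>), or \<open>None\<close> if the game ends with Prover losing. If \<open>b\<close> is a
  proper initial segment of \<open>c(T)\<close>, then the \<open>k\<close> with \<open>c(T) = b * k * \<sigma>\<close> is the entry of
  \<open>c(T)\<close> at index \<open>length b\<close>.
\<close>

fun next_tree :: "nat \<Rightarrow> node set \<Rightarrow> choice \<Rightarrow> node set option" where
  "next_tree h T (Extend b) =
     (let T' = T \<union> {leftmost_leaf T @ [i] | i. i \<le> b}
      in if height T' > h then None else Some T')"
| "next_tree h T (Prune b) =
     (let k = leftmost_leaf T ! length b
      in if b @ [k + 1] \<notin> T then None else Some (T - {b @ [k] @ \<tau> | \<tau>. True}))"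

text \<open>
  \<open>reaches prec h m0 rs T \<rho>\<close>: after Delayer's initial move \<open>m0\<close>, the players can
  legally play the completed rounds \<open>rs\<close>, the game has not ended, and the position reached
  is \<open>(T, \<rho>)\<close>.
\<close>

inductive reaches ::
  "nat rel \<Rightarrow> nat \<Rightarrow> nat \<Rightarrow> game_round list \<Rightarrow> node set \<Rightarrow> partial_pred \<Rightarrow> bool"
  for prec :: "nat rel" and h :: nat and m0 :: nat where
  start: "reaches prec h m0 [] {[]} [m0 \<mapsto> True]"
| step: "\<lbrakk>reaches prec h m0 rs T \<rho>; finite Q; legal_answer prec Q \<rho>'; compatible \<rho> \<rho>';
      legal_choice T ch; next_tree h T ch = Some T'\<rbrakk>
    \<Longrightarrow> reaches prec h m0 (rs @ [(Q, \<rho>', ch)]) T' (\<rho> ++ \<rho>')"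

text \<open>
  A strategy of Delayer is an initial move together with a function computing the answer from
  the completed rounds and the current \<open>Q\<close>. A strategy of Prover consists of two functions, one
  for each of the two moves per round, which are also told the initial move. Both
  are required to make legal moves whenever it is the player's turn.
\<close>

type_synonym delayer_fun = "game_round list \<Rightarrow> nat set \<Rightarrow> partial_pred"
type_synonym query_fun = "nat \<Rightarrow> game_round list \<Rightarrow> nat set"
type_synonym choice_fun = "nat \<Rightarrow> game_round list \<Rightarrow> nat set \<Rightarrow> partial_pred \<Rightarrow> choice"

definition delayer_strategy :: "nat rel \<Rightarrow> nat \<Rightarrow> nat \<times> delayer_fun \<Rightarrow> bool" where
  "delayer_strategy prec h = (\<lambda>(m0, D).
     \<forall>rs T \<rho> Q. reaches prec h m0 rs T \<rho> \<and> finite Q \<longrightarrow> legal_answer prec Q (D rs Q))"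

definition prover_strategy :: "nat rel \<Rightarrow> nat \<Rightarrow> query_fun \<times> choice_fun \<Rightarrow> bool" where
  "prover_strategy prec h = (\<lambda>(A, B).
     \<forall>m0 rs T \<rho>. reaches prec h m0 rs T \<rho> \<longrightarrow>
       (let Q = A m0 rs in
          finite Q
          \<and> (\<forall>\<rho>'. legal_answer prec Q \<rho>' \<and> compatible \<rho> \<rho>' \<longrightarrow>
               legal_choice T (B m0 rs Q \<rho>'))))"

text \<open>
  The next round, and the first \<open>n\<close> rounds, when the two strategies play against each
  other. Rounds after the end of the game are irrelevant and have arbitrary values.
\<close>

fun next_round ::
  "nat \<times> delayer_fun \<Rightarrow> query_fun \<times> choice_fun \<Rightarrow> game_round list \<Rightarrow> game_round" where
  "next_round (m0, D) (A, B) rs =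
     (let Q = A m0 rs; \<rho>' = D rs Q in (Q, \<rho>', B m0 rs Q \<rho>'))"

primrec rounds ::
  "nat \<times> delayer_fun \<Rightarrow> query_fun \<times> choice_fun \<Rightarrow> nat \<Rightarrow> game_round list" where
  "rounds d p 0 = []"
| "rounds d p (Suc n) = rounds d p n @ [next_round d p (rounds d p n)]"

text \<open>
  Delayer wins if in some round Delayer's answer is compatible with \<open>\<rho>\<close> and Prover's choice then
  makes Prover lose. If instead the first incompatible answer comes earlier, no such round is
  reached: the play ends there and Prover wins. An infinite play would not count as a win of
  Delayer either.
\<close>

definition delayer_wins ::
  "nat rel \<Rightarrow> nat \<Rightarrow> nat \<times> delayer_fun \<Rightarrow> query_fun \<times> choice_fun \<Rightarrow> bool" where
  "delayer_wins prec h d p \<longleftrightarrow>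
     (\<exists>n T \<rho> Q \<rho>' ch. reaches prec h (fst d) (rounds d p n) T \<rho>
        \<and> next_round d p (rounds d p n) = (Q, \<rho>', ch)
        \<and> compatible \<rho> \<rho>' \<and> next_tree h T ch = None)"

definition delayer_winning_strategy :: "nat rel \<Rightarrow> nat \<Rightarrow> nat \<times> delayer_fun \<Rightarrow> bool" where
  "delayer_winning_strategy prec h d \<longleftrightarrow>
     delayer_strategy prec h d \<and> (\<forall>p. prover_strategy prec h p \<longrightarrow> delayer_wins prec h d p)"


section \<open>Positions are combs\<close>

lemma leftmost_leaf_eqI:
  assumes "is_leftmost_leaf T \<sigma>"
  shows "leftmost_leaf T = \<sigma>"
  unfolding leftmost_leaf_def
proof (rule the_equality[where P = "is_leftmost_leaf T", OF assms])
  fix \<tau> assume \<tau>: "is_leftmost_leaf T \<tau>"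
  show "\<tau> = \<sigma>"
  proof (rule ccontr)
    assume "\<tau> \<noteq> \<sigma>"
    then have "(\<tau>, \<sigma>) \<in> lexord less_than" "(\<sigma>, \<tau>) \<in> lexord less_than"
      using \<tau> assms by (simp_all add: is_leftmost_leaf_def)
    moreover have "asym less_than" by (auto simp: asym_on_def)
    ultimately show False using lexord_asymmetric by blast
  qed
qed

lemma prefix_less_lexordI:
  assumes "prefix (b @ [i]) \<sigma>" "prefix (b @ [j]) \<tau>" "i < j"
  shows "(\<sigma>, \<tau>) \<in> lexord less_than"
  using assms by (auto simp: prefix_def intro!: lexord_append_leftI)

lemma lexord_not_prefixE:
  assumes "(\<sigma>, \<tau>) \<in> lexord less_than" "\<not> prefix \<sigma> \<tau>"
  obtains b i j where "prefix (b @ [i]) \<sigma>" "prefix (b @ [j]) \<tau>" "(i::nat) < j"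
  using assms by (auto simp: prefix_def lexord_def)

lemma ex_leaf_above:
  assumes "finite T" "\<sigma> \<in> T"
  obtains \<tau> where "\<tau> \<in> leaves T" "prefix \<sigma> \<tau>"
proof -
  let ?S = "{\<tau> \<in> T. prefix \<sigma> \<tau>}"
  have "finite ?S" "?S \<noteq> {}" using assms by auto
  then have "Max (length ` ?S) \<in> length ` ?S" by (intro Max_in) blast+
  then obtain \<tau> where \<tau>1: "Max (length ` ?S) = length \<tau>" "\<tau> \<in> ?S" by (rule imageE)
  have \<tau>2: "length \<upsilon> \<le> length \<tau>" if "\<upsilon> \<in> ?S" for \<upsilon>
    unfolding \<tau>1(1)[symmetric] using that \<open>finite ?S\<close> by (intro Max_ge finite_imageI imageI)
  have "\<tau> @ [k] \<notin> T" for k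
    using \<tau>1(2) \<tau>2[of "\<tau> @ [k]"] by auto
  then show ?thesis using \<tau>1(2) that by (auto simp: leaves_def)
qed

lemma leaves_antichain:
  assumes "rooted_tree T" "\<sigma> \<in> leaves T" "\<tau> \<in> T" "prefix \<sigma> \<tau>"
  shows "\<tau> = \<sigma>"
proof (rule ccontr)
  assume "\<tau> \<noteq> \<sigma>"
  then obtain k \<upsilon> where "\<tau> = \<sigma> @ k # \<upsilon>"
    using assms(4) by (metis append_Nil2 neq_Nil_conv prefix_def)
  then have "prefix (\<sigma> @ [k]) \<tau>" by simp
  then show False using assms by (auto simp: rooted_tree_def leaves_def)
qed

lemma comb_Extend:
  assumes T: "comb h T" and c: "is_leftmost_leaf T c"
    and T': "T' = T \<union> {c @ [i] | i. i \<le> b}" and h: "height T' \<le> h"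
  shows "comb h T' \<and> is_leftmost_leaf T' (c @ [0])"
proof -
  have fin: "finite T" and tree: "rooted_tree T"
    and int: "\<And>\<sigma>. \<sigma> \<in> T - leaves T \<Longrightarrow> \<exists>a b. a \<le> b \<and> {i. \<sigma> @ [i] \<in> T} = {a..b}"
    and par: "\<And>\<sigma> i. \<sigma> @ [i] \<in> leaves T \<Longrightarrow> strict_prefix \<sigma> c"
    using T leftmost_leaf_eqI[OF c] unfolding comb_def by auto
  have cl: "c \<in> leaves T" and cT: "c \<in> T" and ck: "\<And>k. c @ [k] \<notin> T"
    using c by (auto simp: is_leftmost_leaf_def leaves_def)
  have ckj: "c @ [k, j] \<notin> T" for k j
    using tree ck[of k] by (auto simp: rooted_tree_def)
  have T'_iff: "\<sigma> \<in> T' \<longleftrightarrow> \<sigma> \<in> T \<or> (\<exists>i\<le>b. \<sigma> = c @ [i])" for \<sigma>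
    unfolding T' by auto
  have lv: "leaves T' = (leaves T - {c}) \<union> {c @ [i] | i. i \<le> b}"
    unfolding leaves_def T' using cT ck ckj by auto
  have lm: "is_leftmost_leaf T' (c @ [0])"
    unfolding is_leftmost_leaf_def
  proof (intro conjI ballI impI)
    show "c @ [0] \<in> leaves T'" unfolding lv by auto
    fix \<tau> assume \<tau>: "\<tau> \<in> leaves T'" "\<tau> \<noteq> c @ [0]"
    consider i where "\<tau> = c @ [i]" | "\<tau> \<in> leaves T" "\<tau> \<noteq> c" using \<tau> lv by auto
    then show "(c @ [0], \<tau>) \<in> lexord less_than"
    proof cases
      case 1
      then show ?thesis using \<tau>(2) by (intro prefix_less_lexordI[of c 0 _ i]) auto
    next
      case 2
      then have "\<not> prefix c \<tau>" using leaves_antichain[OF tree cl] by (auto simp: leaves_def)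
      moreover have "(c, \<tau>) \<in> lexord less_than" using 2 c by (auto simp: is_leftmost_leaf_def)
      ultimately show ?thesis
        by (metis lexord_not_prefixE prefix_less_lexordI prefix_prefix)
    qed
  qed
  have "comb h T'"
    unfolding comb_def leftmost_leaf_eqI[OF lm]
  proof (intro conjI ballI allI impI)
    show "finite T'" unfolding T' using fin by simp
    show "rooted_tree T'"
      using tree cT unfolding rooted_tree_def T' by (auto simp: prefix_snoc)
    show "height T' \<le> h" by (rule h)
  next
    fix \<sigma> assume \<sigma>: "\<sigma> \<in> T' - leaves T'"
    show "\<exists>a b. a \<le> b \<and> {i. \<sigma> @ [i] \<in> T'} = {a..b}"
    proof (cases "\<sigma> = c")
      case True
      then have "{i. \<sigma> @ [i] \<in> T'} = {0..b}" using ck by (auto simp: T')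
      then show ?thesis by blast
    next
      case False
      moreover have "\<sigma> \<in> T" using \<sigma> lv T'_iff by auto
      ultimately have "\<sigma> \<in> T - leaves T" using \<sigma> lv by auto
      moreover have "{i. \<sigma> @ [i] \<in> T'} = {i. \<sigma> @ [i] \<in> T}" using False by (auto simp: T')
      ultimately show ?thesis using int by simp
    qed
  next
    fix \<sigma> i assume "\<sigma> @ [i] \<in> leaves T'"
    then have "\<sigma> = c \<or> strict_prefix \<sigma> c" using lv par by auto
    then show "strict_prefix \<sigma> (c @ [0])"
      by (auto simp: strict_prefix_def)
  qed
  then show ?thesis using lm by simp
qed

lemma comb_Prune:
  assumes T: "comb h T" and c: "is_leftmost_leaf T c" and b: "strict_prefix b c"
    and k: "k = c ! length b" and k1: "b @ [k + 1] \<in> T"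
    and T': "T' = T - {b @ [k] @ \<tau> | \<tau>. True}"
  shows "comb h T' \<and> is_leftmost_leaf T' (b @ [k + 1])"
proof -
  have fin: "finite T" and tree: "rooted_tree T" and ht: "height T \<le> h"
    and int: "\<And>\<sigma>. \<sigma> \<in> T - leaves T \<Longrightarrow> \<exists>a b. a \<le> b \<and> {i. \<sigma> @ [i] \<in> T} = {a..b}"
    and par: "\<And>\<sigma> i. \<sigma> @ [i] \<in> leaves T \<Longrightarrow> strict_prefix \<sigma> c"
    using T leftmost_leaf_eqI[OF c] unfolding comb_def by auto
  have cl: "c \<in> leaves T" and cT: "c \<in> T"
    and cmin: "\<And>\<tau>. \<tau> \<in> leaves T \<Longrightarrow> \<tau> \<noteq> c \<Longrightarrow> (c, \<tau>) \<in> lexord less_than"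
    using c by (auto simp: is_leftmost_leaf_def leaves_def)
  have T'_iff: "\<sigma> \<in> T' \<longleftrightarrow> \<sigma> \<in> T \<and> \<not> prefix (b @ [k]) \<sigma>" for \<sigma>
    unfolding T' by (auto simp: prefix_def)
  obtain \<sigma>0 where \<sigma>0: "c = b @ k # \<sigma>0"
    using b k by (metis nth_append_length strict_prefixE')
  have bk: "prefix (b @ [k]) c" using \<sigma>0 by simp
  have pc: "prefix \<sigma> b \<or> prefix (b @ [k]) \<sigma>" if "prefix \<sigma> c" for \<sigma>
    using that bk prefix_same_cases[of \<sigma> c "b @ [k]"] by (auto simp: prefix_snoc)
  have k1': "b @ [k + 1] \<in> T'" using k1 by (auto simp: T'_iff prefix_snoc)
  have k1l: "b @ [k + 1] \<in> leaves T"
  proof -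
    obtain \<tau> where \<tau>: "\<tau> \<in> leaves T" "prefix (b @ [k + 1]) \<tau>"
      using ex_leaf_above[OF fin k1] by blast
    have "\<tau> = b @ [k + 1]"
    proof (rule ccontr)
      assume ne: "\<tau> \<noteq> b @ [k + 1]"
      then obtain \<tau>' i where \<tau>': "\<tau> = \<tau>' @ [i]" using \<tau>(2) by (cases \<tau> rule: rev_cases) auto
      then have "prefix (b @ [k + 1]) \<tau>'" using \<tau>(2) ne by (auto simp: prefix_snoc)
      moreover have "prefix \<tau>' c" using par \<tau>(1) \<tau>' by (auto simp: strict_prefix_def)
      ultimately have "prefix (b @ [k + 1]) c" by (rule prefix_order.trans)
      then show False using \<sigma>0 by simp
    qed
    then show ?thesis using \<tau>(1) by simp
  qed
  have child: "\<sigma> @ [i] \<in> T' \<longleftrightarrow> \<sigma> @ [i] \<in> T" if "\<sigma> \<in> T'" "\<sigma> \<noteq> b" for \<sigma> i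
    using that by (auto simp: T'_iff prefix_snoc)
  have lv: "leaves T' = {\<sigma> \<in> leaves T. \<not> prefix (b @ [k]) \<sigma>}"
  proof (rule set_eqI)
    fix \<sigma>
    show "\<sigma> \<in> leaves T' \<longleftrightarrow> \<sigma> \<in> {\<sigma> \<in> leaves T. \<not> prefix (b @ [k]) \<sigma>}"
    proof (cases "\<sigma> = b")
      case True
      then show ?thesis using k1 k1' unfolding leaves_def by auto
    next
      case False
      then show ?thesis using child[of \<sigma>] unfolding leaves_def by (auto simp: T'_iff)
    qed
  qed
  have lm: "is_leftmost_leaf T' (b @ [k + 1])"
    unfolding is_leftmost_leaf_def
  proof (intro conjI ballI impI)
    show "b @ [k + 1] \<in> leaves T'" using k1l unfolding lv by (auto simp: prefix_snoc)
    fix \<tau> assume \<tau>: "\<tau> \<in> leaves T'" "\<tau> \<noteq> b @ [k + 1]"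
    have \<tau>l: "\<tau> \<in> leaves T" and n: "\<not> prefix (b @ [k]) \<tau>" using \<tau>(1) lv by auto
    have "\<tau> \<noteq> c" using n bk by auto
    then have "(c, \<tau>) \<in> lexord less_than" by (rule cmin[OF \<tau>l])
    moreover have "\<not> prefix c \<tau>" using n bk prefix_order.trans by blast
    ultimately obtain d i j where d: "prefix (d @ [i]) c" "prefix (d @ [j]) \<tau>" "i < j"
      by (rule lexord_not_prefixE)
    from pc[OF d(1)] show "(b @ [k + 1], \<tau>) \<in> lexord less_than"
    proof
      assume "prefix (d @ [i]) b"
      then have "prefix (d @ [i]) (b @ [k + 1])" by simp
      then show ?thesis using d(2,3) by (rule prefix_less_lexordI)
    next
      assume "prefix (b @ [k]) (d @ [i])"
      then consider "prefix (b @ [k]) d" | "d = b" "i = k" by (auto simp: prefix_snoc)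
      then show ?thesis
      proof cases
        case 1
        then have "prefix (b @ [k]) (d @ [j])" by simp
        then have "prefix (b @ [k]) \<tau>" using d(2) by (rule prefix_order.trans)
        then show ?thesis using n by simp
      next
        case 2
        have "j \<noteq> k + 1"
        proof
          assume "j = k + 1"
          then have "\<tau> = b @ [k + 1]"
            using leaves_antichain[OF tree k1l] \<tau>l d(2) 2 by (auto simp: leaves_def)
          then show False using \<tau>(2) by simp
        qed
        then have "k + 1 < j" using d(3) 2 by simp
        then show ?thesis using d(2) 2 by (intro prefix_less_lexordI[of b "k + 1" _ j]) auto
      qed
    qed
  qed
  have bT: "b \<in> T" using tree cT b by (auto simp: rooted_tree_def strict_prefix_def)
  have least: "k \<le> i" if i: "b @ [i] \<in> T" for i
  proof (rule ccontr)
    assume "\<not> k \<le> i"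
    obtain \<tau> where \<tau>: "\<tau> \<in> leaves T" "prefix (b @ [i]) \<tau>" using ex_leaf_above[OF fin i] by blast
    have "(\<tau>, c) \<in> lexord less_than"
      using \<tau>(2) bk \<open>\<not> k \<le> i\<close> by (intro prefix_less_lexordI[of b i _ k]) auto
    moreover have "\<tau> \<noteq> c" using \<tau>(2) bk \<open>\<not> k \<le> i\<close> \<sigma>0 by auto
    moreover have "asym (less_than :: nat rel)" by (auto simp: asym_on_def)
    ultimately show False
      using cmin[OF \<tau>(1)] lexord_asymmetric[of less_than \<tau> c] by blast
  qed
  have "comb h T'"
    unfolding comb_def leftmost_leaf_eqI[OF lm]
  proof (intro conjI ballI allI impI)
    show "finite T'" unfolding T' using fin by simp
    show "rooted_tree T'"
      using tree k1' T'_iff unfolding rooted_tree_def by (metis empty_iff prefix_order.trans)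
    have "height T' \<le> height T"
      unfolding height_def using k1' fin by (intro Max_mono) (auto simp: T')
    then show "height T' \<le> h" using ht by simp
  next
    fix \<sigma> assume \<sigma>: "\<sigma> \<in> T' - leaves T'"
    then have "\<sigma> \<in> T - leaves T" unfolding lv by (auto simp: T'_iff)
    then obtain a m where am: "a \<le> m" "{i. \<sigma> @ [i] \<in> T} = {a..m}" using int by blast
    show "\<exists>a b. a \<le> b \<and> {i. \<sigma> @ [i] \<in> T'} = {a..b}"
    proof (cases "\<sigma> = b")
      case True
      have sub: "b @ [i] \<in> T \<longleftrightarrow> a \<le> i \<and> i \<le> m" for i
        using am(2) True by (auto simp: set_eq_iff)
      have "a = k"
        using least[of a] sub[of a] sub[of k] am(1) tree cT bk
        by (auto simp: rooted_tree_def)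
      have "b @ [i] \<in> T' \<longleftrightarrow> b @ [i] \<in> T \<and> i \<noteq> k" for i
        unfolding T'_iff by auto
      then have "\<sigma> @ [i] \<in> T' \<longleftrightarrow> k + 1 \<le> i \<and> i \<le> m" for i
        unfolding \<open>\<sigma> = b\<close> sub \<open>a = k\<close>
        by (metis Suc_eq_plus1 Suc_leI le_neq_implies_less Suc_leD not_less_eq_eq)
      then have "{i. \<sigma> @ [i] \<in> T'} = {k + 1..m}"
        by (simp only: set_eq_iff mem_Collect_eq atLeastAtMost_iff) simp
      moreover have "k + 1 \<le> m" using sub k1 by simp
      ultimately show ?thesis by blast
    next
      case False
      then show ?thesis using child \<sigma> am by auto
    qed
  next
    fix \<sigma> i assume "\<sigma> @ [i] \<in> leaves T'"
    then have l: "\<sigma> @ [i] \<in> leaves T" and n: "\<not> prefix (b @ [k]) (\<sigma> @ [i])" by (auto simp: lv)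
    have "prefix \<sigma> b" using pc[of \<sigma>] par[OF l] n by (auto simp: strict_prefix_def)
    then show "strict_prefix \<sigma> (b @ [k + 1])" by (auto simp: strict_prefix_def)
  qed
  then show ?thesis using lm by simp
qed

theorem reaches_position:
  assumes "reaches prec h m0 rs T \<rho>"
  shows "comb h T \<and> is_leftmost_leaf T (leftmost_leaf T) \<and> finite (dom \<rho>)"
  using assms
proof induction
  case start
  have l: "leaves {[]} = {[]}" by (auto simp: leaves_def)
  have lm: "is_leftmost_leaf {[]} []" unfolding is_leftmost_leaf_def l by simp
  have "comb h {[]}"
    unfolding comb_def leftmost_leaf_eqI[OF lm] l by (auto simp: rooted_tree_def height_def)
  then show ?case using lm leftmost_leaf_eqI[OF lm] by (simp del: fun_upd_apply)
next
  case (step rs T \<rho> Q \<rho>' ch T')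
  have "\<exists>c. comb h T' \<and> is_leftmost_leaf T' c"
  proof (cases ch)
    case (Extend b)
    then show ?thesis
      using step comb_Extend[of h T "leftmost_leaf T" T' b]
      by (auto simp: Let_def split: if_splits)
  next
    case (Prune b)
    then show ?thesis
      using step comb_Prune[of h T "leftmost_leaf T" b _ T']
      by (auto simp: Let_def split: if_splits)
  qed
  then show ?case
    using leftmost_leaf_eqI step by (auto simp: legal_answer_def)
qed

end

theory Submission
  imports Defs
begin

text \<open>
  A position with leftmost leaf \<open>c\<close> of length \<open>d > 0\<close> is ranked by the ordinal
  \<open>\<omega>\<^sup>h\<^sup>-\<^sup>1 r\<^sub>0 + \<dots> + \<omega>\<^sup>h\<^sup>-\<^sup>d r\<^sub>d\<^sub>-\<^sub>1 + \<omega>\<^sup>h\<^sup>-\<^sup>d\<close>, where \<open>r\<^sub>i\<close> counts the siblings to the right of the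
  node of height \<open>i + 1\<close> below \<open>c\<close>, and the initial position is ranked by \<open>\<omega>\<^sup>h\<close>. Every
  non-losing choice of Prover lowers the rank. Delayer starts with an \<open>m\<^sub>0\<close> above an initial
  segment of type \<open>\<omega>\<^sup>h\<^sup>+\<^sup>1 + \<omega> = \<omega> (\<omega>\<^sup>h + 1)\<close>, and at a position of rank \<open>\<beta>\<close> declares true one
  fresh element of the \<open>\<beta>\<close>-th block of type \<open>\<omega>\<close>, besides what was true before, and all
  other queried elements false. A fresh element exists since blocks are infinite, and it lies
  below everything declared true earlier.
\<close>

section \<open>Delayer's strategy from a descending family of infinite blocks\<close>

text \<open>A strategy is given only the rounds; uniqueness lets it recover the position from
  them.\<close>

lemma reaches_deterministic:
  assumes "reaches prec h m0 rs T \<rho>" "reaches prec h m0 rs T' \<rho>'"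
  shows "T' = T \<and> \<rho>' = \<rho>"
  using assms
proof (induction arbitrary: T' \<rho>')
  case start
  then show ?case by (auto elim: reaches.cases)
next
  case (step rs T \<rho> Q \<sigma> ch T1)
  from step.prems obtain T2 \<rho>2 where "reaches prec h m0 rs T2 \<rho>2" "next_tree h T2 ch = Some T'"
    "\<rho>' = \<rho>2 ++ \<sigma>"
    by (auto elim: reaches.cases)
  then show ?case using step.IH step.hyps by fastforce
qed

text \<open>Compatibility forces earlier truths in \<open>Q\<close> to stay true; for fresh
  \<open>m\<close>, it is the only new truth.\<close>

definition descending_answer :: "partial_pred \<Rightarrow> nat set \<Rightarrow> nat \<Rightarrow> partial_pred" where
  "descending_answer \<rho> Q m =
     (\<lambda>q. if q = m then Some True
          else if q \<in> Q then Some (\<rho> q = Some True) else None)"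

lemma dom_descending_answer: "dom (descending_answer \<rho> Q m) = insert m Q"
  by (auto simp: descending_answer_def split: if_splits)

text \<open>\<open>m\<close> is the smaller witness for every true query, and needs none itself
  because it is not queried.\<close>

lemma legal_descending_answer:
  assumes "finite Q" "m \<notin> Q" "\<And>q. \<rho> q = Some True \<Longrightarrow> (m, q) \<in> prec - Id"
  shows "legal_answer prec Q (descending_answer \<rho> Q m)"
  unfolding legal_answer_def dom_descending_answer
  using assms by (auto simp: descending_answer_def split: if_splits)

lemma compatible_descending_answer:
  assumes "m \<notin> dom \<rho>"
  shows "compatible \<rho> (descending_answer \<rho> Q m)"
  using assms by (auto simp: compatible_def descending_answer_def)

lemma descending_answer_True:
  assumes "(\<rho> ++ descending_answer \<rho> Q m) q = Some True"
  shows "q = m \<or> \<rho> q = Some True"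
  using assms by (auto simp: descending_answer_def map_add_def split: if_splits)

text \<open>Invariant: the whole block \<open>mark T\<close> lies strictly below everything declared
  true so far. Injectivity makes the block infinite, so it has an element outside \<open>Q\<close>
  and \<open>dom \<rho>\<close>; well-foundedness ends the play.\<close>

lemma delayer_winning_strategyI:
  fixes mark :: "node set \<Rightarrow> nat \<Rightarrow> nat"
  assumes wf: "wf (prec - Id)" and trans: "trans (prec - Id)"
    and inj: "\<And>T. inj (mark T)"
    and init: "\<And>n. (mark {[]} n, m0) \<in> prec - Id"
    and decr: "\<And>T ch T' n n'. comb h T \<Longrightarrow> is_leftmost_leaf T (leftmost_leaf T) \<Longrightarrow>
      legal_choice T ch \<Longrightarrow> next_tree h T ch = Some T' \<Longrightarrow> (mark T' n', mark T n) \<in> prec - Id"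
  shows "\<exists>d. delayer_winning_strategy prec h d"
proof -
  define fresh where "fresh T \<rho> Q = mark T (SOME n. mark T n \<notin> Q \<union> dom \<rho>)"
    for T and \<rho> :: partial_pred and Q
  define pos where "pos rs = (SOME (T, \<rho>). reaches prec h m0 rs T \<rho>)" for rs
  define ans where "ans rs Q = (case pos rs of (T, \<rho>) \<Rightarrow> descending_answer \<rho> Q (fresh T \<rho> Q))"
    for rs Q
  txt \<open>A strategy must answer legally also after histories it would not have produced itself.\<close>
  define D where "D rs Q =
      (if legal_answer prec Q (ans rs Q) then ans rs Q
       else (\<lambda>q. if q \<in> Q then Some False else None))" for rs Q
  have pos: "pos rs = (T, \<rho>)" if "reaches prec h m0 rs T \<rho>" for rs T \<rho>
  proof -
    have "(\<lambda>(T, \<rho>). reaches prec h m0 rs T \<rho>) (pos rs)"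
      unfolding pos_def by (rule someI[of _ "(T, \<rho>)"]) (simp add: that)
    then show ?thesis using reaches_deterministic[OF that] by (cases "pos rs") simp
  qed
  have fresh: "\<exists>n. fresh T \<rho> Q = mark T n" "fresh T \<rho> Q \<notin> Q \<union> dom \<rho>"
    if "finite Q" "finite (dom \<rho>)" for T \<rho> Q
  proof -
    show "\<exists>n. fresh T \<rho> Q = mark T n" by (auto simp: fresh_def)
    have "\<exists>n. mark T n \<notin> Q \<union> dom \<rho>"
      using finite_imageD[OF finite_subset[of "range (mark T)" "Q \<union> dom \<rho>"] inj[of T]] that
      by auto
    then show "fresh T \<rho> Q \<notin> Q \<union> dom \<rho>" unfolding fresh_def by (rule someI_ex)
  qed
  have "delayer_strategy prec h (m0, D)"
    unfolding delayer_strategy_def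
  proof clarsimp
    fix Q :: "nat set" and rs assume Q: "finite Q"
    have "dom (\<lambda>q. if q \<in> Q then Some False else None) = Q" by (auto split: if_splits)
    then show "legal_answer prec Q (D rs Q)"
      using Q unfolding D_def by (auto simp: legal_answer_def split: if_splits)
  qed
  moreover have "delayer_wins prec h (m0, D) p" if p: "prover_strategy prec h p" for p
  proof -
    obtain A B where AB: "p = (A, B)" by (cases p)
    let ?d = "(m0, D)"
    have "delayer_wins prec h ?d p"
      if "reaches prec h m0 (rounds ?d p n) T \<rho>"
        "\<And>q k. \<rho> q = Some True \<Longrightarrow> (mark T k, q) \<in> prec - Id" for n T \<rho>
      using that
    \<comment> \<open>Index 0 is an arbitrary choice: \<open>decr\<close> compares all points of the
      two blocks.\<close>
    proof (induction "mark T 0" arbitrary: n T \<rho> rule: wf_induct_rule[OF wf])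
      case 1
      note R = \<open>reaches prec h m0 (rounds ?d p n) T \<rho>\<close>
      let ?rs = "rounds ?d p n"
      define Q where "Q = A m0 ?rs"
      define m where "m = fresh T \<rho> Q"
      define \<rho>' where "\<rho>' = descending_answer \<rho> Q m"
      define ch where "ch = B m0 ?rs Q \<rho>'"
      have T: "comb h T" "is_leftmost_leaf T (leftmost_leaf T)" "finite (dom \<rho>)"
        using reaches_position[OF R] by auto
      have Q: "finite Q" using p R unfolding AB prover_strategy_def Q_def by (auto simp: Let_def)
      obtain k where k: "m = mark T k" using fresh(1)[OF Q T(3)] by (auto simp: m_def)
      have m: "m \<notin> Q" "m \<notin> dom \<rho>" using fresh(2)[OF Q T(3), of T] by (auto simp: m_def)
      have legal: "legal_answer prec Q \<rho>'"
        unfolding \<rho>'_def using Q m(1) 1(3) k by (intro legal_descending_answer) auto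
      have comp: "compatible \<rho> \<rho>'"
        unfolding \<rho>'_def using m(2) by (rule compatible_descending_answer)
      have "ans ?rs Q = \<rho>'" using pos[OF R] by (simp add: ans_def \<rho>'_def m_def)
      then have D: "D ?rs Q = \<rho>'" using legal by (simp add: D_def)
      have nr: "next_round ?d p ?rs = (Q, \<rho>', ch)"
        unfolding AB ch_def D[symmetric] by (simp add: Let_def Q_def AB)
      have lch: "legal_choice T ch"
        using p R legal comp unfolding AB prover_strategy_def ch_def Q_def by (auto simp: Let_def)
      show ?case
      proof (cases "next_tree h T ch")
        case None
        then show ?thesis using R nr comp unfolding delayer_wins_def by fastforce
      next
        case (Some T')
        note less = decr[OF T(1,2) lch Some]
        have R': "reaches prec h m0 (rounds ?d p (Suc n)) T' (\<rho> ++ \<rho>')"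
          using reaches.step[OF R Q legal comp lch Some] nr by simp
        \<comment> \<open>The new truth \<open>m\<close> lies in the old block, hence above the new
          one; earlier truths follow by transitivity.\<close>
        have "(mark T' k', q) \<in> prec - Id" if "(\<rho> ++ \<rho>') q = Some True" for q k'
          using descending_answer_True[OF that[unfolded \<rho>'_def]]
        proof
          assume "q = m"
          then show ?thesis using k less by simp
        next
          assume "\<rho> q = Some True"
          then show ?thesis using 1(3) less trans by (meson transD)
        qed
        then show ?thesis using 1(1)[OF less R'] by blast
      qed
    qed
    moreover have "reaches prec h m0 (rounds ?d p 0) {[]} [m0 \<mapsto> True]"
      by (simp add: reaches.start)
    moreover have "(mark {[]} k, q) \<in> prec - Id" if "[m0 \<mapsto> True] q = Some True" for q k
      using that init by (auto split: if_splits)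
    ultimately show ?thesis by blast
  qed
  ultimately show ?thesis unfolding delayer_winning_strategy_def by blast
qed

section \<open>Ranks of positions\<close>

definition right_siblings :: "node set \<Rightarrow> nat \<Rightarrow> nat" where
  "right_siblings T i =
     card {j. leftmost_leaf T ! i < j \<and> take i (leftmost_leaf T) @ [j] \<in> T}"

text \<open>The coefficient of \<omega>^(h-1-i) in the rank. The \<open>Suc\<close> at the last
  index is the final summand \<omega>^(h-d), where d is the length of the leaf.\<close>

definition rank_coeff :: "node set \<Rightarrow> nat \<Rightarrow> nat" where
  "rank_coeff T i =
     (if Suc i < length (leftmost_leaf T) then right_siblings T i
      else if Suc i = length (leftmost_leaf T) then Suc (right_siblings T i) else 0)"

text \<open>
  The \<open>n\<close>-th element of the block of type \<open>\<omega>\<close> belonging to \<open>T\<close>, as a point of the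
  ordinal \<open>\<omega>\<^sup>h\<^sup>+\<^sup>1 + \<omega>\<close>.
\<close>

definition block_point :: "nat \<Rightarrow> node set \<Rightarrow> nat \<Rightarrow> nat list + nat" where
  "block_point h T n =
     (if leftmost_leaf T = [] then Inr n else Inl (map (rank_coeff T) [0..<h] @ [n]))"

lemma inj_block_point: "inj (block_point h T)"
  by (auto simp: inj_def block_point_def)

section \<open>The lexicographic order on powers of \<omega>\<close>

text \<open>The head is the most significant entry, since it codes the right factor of the
  product.\<close>

lemma omega_pow_Cons:
  "(x # xs, y # ys) \<in> omega_pow (Suc n) \<longleftrightarrow>
     xs \<in> Field (omega_pow n) \<and> ys \<in> Field (omega_pow n) \<and> (x < y \<or> x = y \<and> (xs, ys) \<in> omega_pow n)"
proof -
  have "(x, y) \<in> natLeq \<longleftrightarrow> x \<le> y" by (simp add: natLeq_def)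
  then show ?thesis by (auto simp: dir_image_def ord_prod_iff Field_natLeq)
qed

lemma Field_omega_pow: "xs \<in> Field (omega_pow n) \<longleftrightarrow> length xs = n"
proof (induction n arbitrary: xs)
  case 0
  then show ?case by (auto simp: Field_def)
next
  case (Suc n)
  have refl: "Refl (omega_pow n)" using Well_order_omega_pow[of n] by (simp add: Well_order_iff)
  have "xs \<in> Field (omega_pow (Suc n)) \<longleftrightarrow>
      (\<exists>y ys. xs = y # ys \<and> (ys, y) \<in> Field (ord_prod (omega_pow n) natLeq))"
    by (force simp: dir_image_Field)
  then show ?case by (auto simp: Field_ord_prod[OF refl] Suc.IH Field_natLeq length_Suc_conv)
qed

text \<open>The tails are constrained only in length, so lower coefficients may grow arbitrarily
  after a drop.\<close>

lemma omega_pow_lex: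
  assumes "length us + Suc (length vs) = n" "length ws = length vs" "x < y"
  shows "(us @ x # vs, us @ y # ws) \<in> omega_pow n"
  using assms
proof (induction us arbitrary: n)
  case Nil
  then show ?case by (auto simp: omega_pow_Cons Field_omega_pow simp del: omega_pow.simps)
next
  case (Cons u us)
  then show ?case
    by (cases n) (auto simp: omega_pow_Cons Field_omega_pow simp del: omega_pow.simps)
qed

lemma omega_pow_map_less:
  assumes "i < h" "f i < g i" "\<And>j. j < i \<Longrightarrow> f j \<le> g j"
  shows "(map f [0..<h] @ [m], map g [0..<h] @ [n]) \<in> omega_pow (h + 1)"
proof -
  \<comment> \<open>The drop at \<open>i\<close> need not be the first one; before the first one,
    \<open>l\<close>, the two lists agree.\<close>
  obtain l where l: "f l < g l" and least: "\<forall>j<l. \<not> f j < g j"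
    using exists_least_iff[of "\<lambda>l. f l < g l"] assms(2) by blast
  have "l \<le> i" using assms(2) least by (meson not_le)
  have "f j = g j" if "j < l" for j
    using assms(3)[of j] least that \<open>l \<le> i\<close> by (auto simp: le_less)
  then have "map f [0..<l] = map g [0..<l]" by simp
  moreover have "[0..<h] = [0..<l] @ l # [Suc l..<h]"
    using assms(1) \<open>l \<le> i\<close> upt_add_eq_append[of 0 l "h - l"] upt_conv_Cons[of l h] by simp
  ultimately have "map f [0..<h] = map g [0..<l] @ f l # map f [Suc l..<h]"
    "map g [0..<h] = map g [0..<l] @ g l # map g [Suc l..<h]"
    by simp_all
  then show ?thesis
    using omega_pow_lex[of "map g [0..<l]" "map f [Suc l..<h] @ [m]" "h + 1"
      "map g [Suc l..<h] @ [n]" "f l" "g l"] assms(1) l \<open>l \<le> i\<close>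
    by (simp del: omega_pow.simps)
qed

text \<open>An empty leftmost leaf puts the block of \<open>T\<close> in the top copy of \<omega>,
  above the whole left summand; otherwise the coefficients decide.\<close>

lemma block_point_less:
  assumes "leftmost_leaf T' \<noteq> []"
    and "leftmost_leaf T \<noteq> [] \<Longrightarrow>
      \<exists>i<h. rank_coeff T' i < rank_coeff T i \<and> (\<forall>j<i. rank_coeff T' j \<le> rank_coeff T j)"
  shows "(block_point h T' n', block_point h T n) \<in> ord_sum (omega_pow (h + 1)) natLeq - Id"
proof (cases "leftmost_leaf T = []")
  case True
  then show ?thesis using assms(1)
    by (simp add: block_point_def ord_sum_iff Field_omega_pow Field_natLeq
        del: omega_pow.simps)
next
  case False
  then obtain i where i: "i < h" "rank_coeff T' i < rank_coeff T i"
    "\<And>j. j < i \<Longrightarrow> rank_coeff T' j \<le> rank_coeff T j"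
    using assms(2) by blast
  then have "map (rank_coeff T') [0..<h] \<noteq> map (rank_coeff T) [0..<h]"
    by (metis atLeastLessThan_iff less_irrefl map_eq_conv set_upt zero_le)
  then show ?thesis using False assms(1) omega_pow_map_less[of i h "rank_coeff T'", OF i]
    by (simp add: block_point_def ord_sum_iff del: omega_pow.simps)
qed

section \<open>Every non-losing choice lowers the rank\<close>

lemma block_point_decreases:
  assumes T: "comb h T" "is_leftmost_leaf T (leftmost_leaf T)"
    and ch: "legal_choice T ch" "next_tree h T ch = Some T'"
  shows "(block_point h T' n', block_point h T n) \<in> ord_sum (omega_pow (h + 1)) natLeq - Id"
proof (cases ch)
  case (Extend b)
  define c where "c = leftmost_leaf T"
  have T': "T' = T \<union> {c @ [i] | i. i \<le> b}" "height T' \<le> h"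
    using ch(2) unfolding Extend c_def by (auto simp: Let_def split: if_splits)
  then have 1: "comb h T'" "leftmost_leaf T' = c @ [0]"
    using comb_Extend[OF T] leftmost_leaf_eqI unfolding c_def by blast+
  have "length (c @ [0]) \<le> height T'"
    unfolding height_def using 1(1) T'(1) unfolding comb_def by (intro Max_ge finite_imageI imageI) auto
  then have len: "length c < h" using T'(2) by simp
  have sib: "right_siblings T' j = right_siblings T j" if "j < length c" for j
  proof -
    \<comment> \<open>The added nodes are longer than \<open>take j c @ [l]\<close>.\<close>
    have "take j c @ [l] \<in> T' \<longleftrightarrow> take j c @ [l] \<in> T" for l
      using that arg_cong[of "take j c @ [l]" _ length] unfolding T'(1) by fastforce
    then show ?thesis using that unfolding right_siblings_def 1(2) by (simp add: nth_append c_def)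
  qed
  show ?thesis
  proof (rule block_point_less, unfold 1(2) c_def[symmetric])
    \<comment> \<open>The last coefficient of \<open>c\<close> loses its \<open>Suc\<close>, which
      pays for all the new siblings one level lower.\<close>
    assume "c \<noteq> []"
    then obtain i where "length c = Suc i" by (cases c) auto
    then show "\<exists>i<h. rank_coeff T' i < rank_coeff T i \<and> (\<forall>j<i. rank_coeff T' j \<le> rank_coeff T j)"
      using len sib unfolding rank_coeff_def 1(2) c_def[symmetric] by (intro exI[of _ i]) auto
  qed simp
next
  case (Prune b)
  define c where "c = leftmost_leaf T"
  define k where "k = c ! length b"
  have b: "strict_prefix b c" using ch(1) Prune by (simp add: c_def)
  have k1: "b @ [k + 1] \<in> T" and T': "T' = T - {b @ [k] @ \<tau> | \<tau>. True}"
    using ch(2) unfolding Prune k_def c_def by (auto simp: Let_def split: if_splits)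
  have c': "leftmost_leaf T' = b @ [k + 1]"
    using comb_Prune[OF T _ _ k1 T'] b leftmost_leaf_eqI unfolding k_def c_def by blast
  obtain s where c: "c = b @ k # s"
    using b k_def by (metis nth_append_length strict_prefixE')
  have cT: "c \<in> T" using T(2) by (simp add: is_leftmost_leaf_def leaves_def c_def)
  have fin: "finite T" using T(1) by (simp add: comb_def)
  have "length c \<le> height T" unfolding height_def using fin cT by simp
  then have len: "length b < h" using T(1) c by (simp add: comb_def)
  have sib: "right_siblings T' j = right_siblings T j" if "j < length b" for j
  proof -
    have "take j b @ [l] \<noteq> b @ k # \<tau>" for l \<tau>
    proof
      assume "take j b @ [l] = b @ k # \<tau>"
      from arg_cong[OF this, of length] show False using that by simp
    qed
    then show ?thesis using that
      unfolding right_siblings_def c' c_def[symmetric] c by (simp add: nth_append T')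
  qed
  \<comment> \<open>The leaf passes to child \<open>k + 1\<close>, which thereby stops counting as a
    right sibling.\<close>
  have "{j. k < j \<and> b @ [j] \<in> T} = insert (k + 1) {j. k + 1 < j \<and> b @ [j] \<in> T'}"
    using k1 by (auto simp: T')
  moreover have "finite {j. b @ [j] \<in> T'}"
    using finite_vimageI[of T' "\<lambda>j. b @ [j]"] fin by (simp add: T' inj_def vimage_def)
  then have "finite {j. k + 1 < j \<and> b @ [j] \<in> T'}" by (rule finite_subset[rotated]) auto
  ultimately have sib': "right_siblings T (length b) = Suc (right_siblings T' (length b))"
    unfolding right_siblings_def c' c_def[symmetric] c by simp
  show ?thesis
  proof (rule block_point_less, unfold c' c_def[symmetric])
    show "\<exists>i<h. rank_coeff T' i < rank_coeff T i \<and> (\<forall>j<i. rank_coeff T' j \<le> rank_coeff T j)"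
    \<comment> \<open>If the leaf itself is pruned, both coefficients at \<open>length b\<close>
      carry the \<open>Suc\<close> and one sibling is lost.\<close>
    proof (cases "s = []")
      case True
      then show ?thesis using len sib sib'
        unfolding rank_coeff_def c' c_def[symmetric] c by (intro exI[of _ "length b"]) auto
    next
      case False
      \<comment> \<open>Here the \<open>Suc\<close> moves up to \<open>length b\<close> and makes up
        for the lost sibling, so the strict drop comes at the last index \<open>i\<close> of
        \<open>c\<close>, where the coefficient becomes 0.\<close>
      then obtain i where i: "length c = Suc i" "length b < i" unfolding c by (cases s) auto
      have "rank_coeff T' j \<le> rank_coeff T j" if "j < i" for j
        using that i sib sib' unfolding rank_coeff_def c' c_def[symmetric]
        by (cases j "length b" rule: linorder_cases) auto
      moreover have "rank_coeff T' i < rank_coeff T i"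
        using i unfolding rank_coeff_def c' c_def[symmetric] by simp
      moreover have "i < h" using i \<open>length c \<le> height T\<close> T(1) by (simp add: comb_def)
      ultimately show ?thesis by blast
    qed
  qed simp
qed

section \<open>Transfer to the given well-order\<close>

theorem proposition3p7:
  fixes prec :: "nat rel" and h :: nat
  assumes "well_order_on UNIV prec"
    and "h > 0"
    and "(ord_sum (omega_pow (h + 1)) natLeq, prec) \<in> ordLess"
  shows "\<exists>d. delayer_winning_strategy prec h d"
proof -
  let ?r = "ord_sum (omega_pow (h + 1)) natLeq"
  have F: "Field prec = UNIV" using well_order_on_Field[OF assms(1)] by simp
  have wo: "Well_order prec" using assms(1) F by simp
  have r: "Well_order ?r"
    by (intro Well_order_ord_sum Well_order_omega_pow natLeq_Well_order)
  \<comment> \<open>Strictness yields a point whose proper predecessors form a copy of the ordinal;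
    it is Delayer's initial move.\<close>
  obtain m0 where "(?r, Restr prec (underS prec m0)) \<in> ordIso"
    using assms(3) ordLess_iff_ordIso_Restr[OF wo r] by blast
  then obtain f where f: "iso ?r (Restr prec (underS prec m0)) f"
    unfolding ordIso_def by auto
  have Fr: "Field (Restr prec (underS prec m0)) \<subseteq> underS prec m0" by (auto simp: Field_def)
  have bij: "bij_betw f (Field ?r) (Field (Restr prec (underS prec m0)))"
    using f by (simp add: iso_def)
  have mono: "(f x, f y) \<in> prec - Id" if "(x, y) \<in> ?r - Id" for x y
  proof -
    have "(f x, f y) \<in> prec" using iso_forward[OF _ f] that by blast
    moreover have "f x \<noteq> f y"
      using bij that unfolding bij_betw_def inj_on_def by (blast intro: FieldI1 FieldI2)
    ultimately show ?thesis by simp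
  qed
  have in_field: "block_point h T n \<in> Field ?r" for T n
    by (simp add: block_point_def Inl_Field_ord_sum Inr_Field_ord_sum Field_omega_pow
        Field_natLeq del: omega_pow.simps)
  show ?thesis
  proof (rule delayer_winning_strategyI[where mark = "\<lambda>T n. f (block_point h T n)" and ?m0.0 = m0])
    show "wf (prec - Id)" using wo by (simp add: Well_order_iff)
    show "trans (prec - Id)" using wo by (simp add: Well_order_iff trans_diff_Id)
    show "inj (\<lambda>n. f (block_point h T n))" for T
    proof (rule injI)
      fix x y assume "f (block_point h T x) = f (block_point h T y)"
      then have "block_point h T x = block_point h T y"
        using bij_betw_imp_inj_on[OF bij] in_field by (metis inj_onD)
      then show "x = y" using inj_block_point by (metis injD)
    qed
    show "(f (block_point h {[]} n), m0) \<in> prec - Id" for n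
    proof -
      have "f (block_point h {[]} n) \<in> underS prec m0"
        using bij_betwE[OF bij] in_field[of "{[]}" n] Fr by blast
      then show ?thesis by (simp add: underS_def)
    qed
    show "(f (block_point h T' n'), f (block_point h T n)) \<in> prec - Id"
      if "comb h T" "is_leftmost_leaf T (leftmost_leaf T)" "legal_choice T ch"
        "next_tree h T ch = Some T'" for T ch T' n n'
      using block_point_decreases[OF that] by (rule mono)
  qed
qed

end
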